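(* Let $a_i,b_i,c_i\in\mathbb{R}$ ($i=1,2,3$), $\beta_1=b_2+b_3$, $\beta_2=b_1+b_3$, $\beta_3=b_1+b_2$, be such that the matrix $$A=\begin{pmatrix}a_1&\beta_1&c_1\\ a_2&\beta_2&c_2\\ a_3&\beta_3&c_3\end{pmatrix}$$ is generating and has non-zero discriminant $\Delta(A)\neq0$. Let $\phi,\psi,\zeta$ be nonconstant $C^2$ functions of one variable, defined near $0$, satisfying $$\phi'^2=a_1-2b_1\phi^2+c_1\phi^4,\qquad \psi'^2=a_2-2b_2\psi^2+c_2\psi^4,\qquad \zeta'^2=c_3+2b_3\zeta^2+a_3\zeta^4,$$ and let $z=u(x,y)$ be a continuous function in a neighbourhood of $(0,0)$ with $u(0,0)=0$ and $\zeta(u(x,y))=\phi(x)\psi(y)$. If $(0,0)$ is an isolated nonremovable singularity of $u$, then $$u(x,y)=\delta\sqrt{x^2+y^2}+O(x^2+y^2),\qquad (x,y)\to(0,0),$$ where $\delta\in\{1,-1\}$.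
   Context: A non-zero real $3\times3$ matrix $A=(a_{ij})$ is generating if for all permutations $(i,j,k)$ and $(\alpha,\beta,\gamma)$ of $\{1,2,3\}$ one has $a_{i\alpha}a_{i\beta}=a_{j\gamma}a_{k\gamma}$. For the generating matrix $A$ in the claim, the discriminant is $\Delta(A)=b_i^2-a_ic_i$, which has the same value for $i=1,2,3$. A point $m_0=(x_0,y_0)$ with $z_0=u(x_0,y_0)$ is an isolated nonremovable singularity of $u$ if $\zeta'(z_0)=0$ (together with $\zeta(z_0)=\phi(x_0)\psi(y_0)$), $u$ is $C^2$ in a punctured neighbourhood of $m_0$, but $u$ has no $C^2$ continuation at $m_0$. *)

theory Defs
  imports "HOL-Analysis.Analysis" "HOL-Library.Landau_Symbols"
begin

(* Meant for open S: the derivatives are taken "at x", not "at x within S". *)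
definition C2_on :: "'a::real_normed_vector set \<Rightarrow> ('a \<Rightarrow> 'b::real_normed_vector) \<Rightarrow> bool" where
  "C2_on S f \<longleftrightarrow>
     (\<exists>(f' :: 'a \<Rightarrow> 'a \<Rightarrow>\<^sub>L 'b) (f'' :: 'a \<Rightarrow> 'a \<Rightarrow>\<^sub>L 'a \<Rightarrow>\<^sub>L 'b).
        (\<forall>x\<in>S. (f has_derivative blinfun_apply (f' x)) (at x)) \<and>
        (\<forall>x\<in>S. (f' has_derivative blinfun_apply (f'' x)) (at x)) \<and>
        continuous_on S f'')"

(* A permutation (i,j,k) of the three indices is given as (p 1, p 2, p 3). *)
definition generating :: "real^3^3 \<Rightarrow> bool" where
  "generating A \<longleftrightarrow> A \<noteq> 0 \<and>
     (\<forall>p q. p permutes UNIV \<longrightarrow> q permutes UNIV \<longrightarrow>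
        A $ p 1 $ q 1 * A $ p 1 $ q 2 = A $ p 2 $ q 3 * A $ p 3 $ q 3)"

definition coeff_matrix :: "real^3 \<Rightarrow> real^3 \<Rightarrow> real^3 \<Rightarrow> real^3^3" where
  "coeff_matrix a b c = vector
     [vector [a $ 1, b $ 2 + b $ 3, c $ 1],
      vector [a $ 2, b $ 1 + b $ 3, c $ 2],
      vector [a $ 3, b $ 1 + b $ 2, c $ 3]]"

definition discriminant :: "real^3 \<Rightarrow> real^3 \<Rightarrow> real^3 \<Rightarrow> real" where
  "discriminant a b c = (b $ 1)\<^sup>2 - a $ 1 * c $ 1"

(* The choice of the index 1 in the discriminant is immaterial for generating matrices. *)
lemma discriminant_eq:
  assumes "generating (coeff_matrix a b c)"
  shows "discriminant a b c = (b $ i)\<^sup>2 - a $ i * c $ i"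
proof -
  have p: "A $ p 1 $ q 1 * A $ p 1 $ q 2 = A $ p 2 $ q 3 * A $ p 3 $ q 3"
    if "A = coeff_matrix a b c" "p permutes UNIV" "q permutes UNIV" for A p q
    using assms that by (auto simp: generating_def)
  have q: "Transposition.transpose 2 (3::3) permutes UNIV"
    and r: "Transposition.transpose 1 (2::3) permutes UNIV"
    and s: "Transposition.transpose 1 (3::3) permutes UNIV"
    by (auto intro: permutes_swap_id)
  have 1: "a $ 1 * c $ 1 = (b $ 1 + b $ 3) * (b $ 1 + b $ 2)"
    using p[OF refl permutes_id q]
    by (simp add: coeff_matrix_def vector_3 Transposition.transpose_def)
  have 2: "a $ 2 * c $ 2 = (b $ 2 + b $ 3) * (b $ 1 + b $ 2)"
    using p[OF refl r q]
    by (simp add: coeff_matrix_def vector_3 Transposition.transpose_def)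
  have 3: "a $ 3 * c $ 3 = (b $ 1 + b $ 3) * (b $ 2 + b $ 3)"
    using p[OF refl s q]
    by (simp add: coeff_matrix_def vector_3 Transposition.transpose_def)
  show ?thesis
    using exhaust_3[of i] 1 2 3
    by (auto simp: discriminant_def power2_eq_square algebra_simps)
qed

definition isolated_nonremovable_singularity ::
  "(real \<Rightarrow> real) \<Rightarrow> (real \<Rightarrow> real) \<Rightarrow> (real \<Rightarrow> real) \<Rightarrow> (real \<times> real \<Rightarrow> real) \<Rightarrow> real \<times> real \<Rightarrow> bool"
where
  "isolated_nonremovable_singularity \<phi> \<psi> \<zeta> u m \<longleftrightarrow>
     deriv \<zeta> (u m) = 0 \<and> \<zeta> (u m) = \<phi> (fst m) * \<psi> (snd m) \<and>
     (\<exists>V. open V \<and> m \<in> V \<and> C2_on (V - {m}) u) \<and>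
     \<not> (\<exists>V v. open V \<and> m \<in> V \<and> C2_on V v \<and> (\<forall>p\<in>V - {m}. v p = u p))"

end

theory Submission
  imports Defs
begin

text \<open>
  The discriminant condition makes \<open>\<zeta> 0\<close> a simple root of the quartic for \<open>\<zeta>\<close>: at a double root
  the first-order equation would force \<open>\<zeta>\<close> to be constant. Hence
  \<open>\<zeta> z = w + w s z\<^sup>2 + O(z\<^sup>3)\<close> with \<open>w = \<zeta> 0 = p q\<close>, \<open>p = \<phi> 0\<close>, \<open>q = \<psi> 0\<close> all
  nonzero and \<open>s\<^sup>2 = \<Delta>\<close>. So \<open>\<zeta> (u (x, y)) - w\<close> has the sign of \<open>w s\<close> near the origin, and the
  restrictions of \<open>\<phi> x \<psi> y\<close> to the two axes have an extremum at \<open>0\<close>. This gives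
  \<open>\<phi>' 0 = \<psi>' 0 = 0\<close>, and since the discriminant is the same for all three equations,
  \<open>\<phi> x = p + p s x\<^sup>2 + O(x\<^sup>3)\<close> and \<open>\<psi> y = q + q s y\<^sup>2 + O(y\<^sup>3)\<close> with the same \<open>s\<close>. Comparing,
  \<open>u\<^sup>2 = r\<^sup>2 + O(r\<^sup>3)\<close> with \<open>r\<^sup>2 = x\<^sup>2 + y\<^sup>2\<close>, and \<open>u\<close> has constant sign on a punctured disc.
\<close>

section \<open>Preliminaries from one-variable calculus\<close>

lemma C2_on_real_derivatives:
  fixes f :: "real \<Rightarrow> real"
  assumes "C2_on S f"
  obtains g h where "\<And>x. x \<in> S \<Longrightarrow> (f has_real_derivative g x) (at x)"
    and "\<And>x. x \<in> S \<Longrightarrow> (g has_real_derivative h x) (at x)"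
    and "continuous_on S h"
proof -
  obtain f' :: "real \<Rightarrow> real \<Rightarrow>\<^sub>L real" and f'' :: "real \<Rightarrow> real \<Rightarrow>\<^sub>L real \<Rightarrow>\<^sub>L real"
    where 1: "\<And>x. x \<in> S \<Longrightarrow> (f has_derivative blinfun_apply (f' x)) (at x)"
      and 2: "\<And>x. x \<in> S \<Longrightarrow> (f' has_derivative blinfun_apply (f'' x)) (at x)"
      and 3: "continuous_on S f''"
    using assms unfolding C2_on_def by blast
  show thesis
  proof
    fix x assume x: "x \<in> S"
    show "(f has_real_derivative f' x 1) (at x)"
      using 1[OF x] by (rule has_derivative_imp_has_field_derivative)
        (metis blinfun.scaleR_right mult.right_neutral real_scaleR_def)
    have "((\<lambda>t. f' t 1) has_derivative (\<lambda>t. f'' x t 1)) (at x)"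
      using blinfun.FDERIV[OF 2[OF x] has_derivative_const[of 1]] by simp
    then show "((\<lambda>t. f' t 1) has_real_derivative f'' x 1 1) (at x)"
    proof (rule has_derivative_imp_has_field_derivative)
      fix t
      have "f'' x t = t *\<^sub>R f'' x 1"
        by (metis blinfun.scaleR_right mult.right_neutral real_scaleR_def)
      then show "t * f'' x 1 1 = f'' x t 1"
        by (simp add: blinfun.scaleR_left)
    qed
  next
    show "continuous_on S (\<lambda>x. f'' x 1 1)"
      by (intro continuous_intros 3)
  qed
qed

text \<open>Gronwall with the weight \<open>exp (- (2 * M) * x)\<close>: the bound gives
  \<open>f * g \<le> M * f^2\<close>, so the weighted square of \<open>f\<close> is nonincreasing.
  It is nonnegative and starts at zero. Squaring avoids any discussion of the sign of
  \<open>f\<close>.\<close>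

lemma zero_forward_if_derivative_bound:
  fixes f g :: "real \<Rightarrow> real"
  assumes "a \<le> b"
    and df: "\<And>x. x \<in> {a..b} \<Longrightarrow> (f has_real_derivative g x) (at x)"
    and bound: "\<And>x. x \<in> {a..b} \<Longrightarrow> \<bar>g x\<bar> \<le> M * \<bar>f x\<bar>"
    and "f a = 0"
  shows "f b = 0"
proof -
  let ?F = "\<lambda>x. (f x)\<^sup>2 * exp (- (2 * M) * x)"
  have "?F b \<le> ?F a"
  proof (rule DERIV_nonpos_imp_nonincreasing[OF \<open>a \<le> b\<close>])
    fix x assume x: "a \<le> x" "x \<le> b"
    have "f x * g x \<le> \<bar>f x\<bar> * \<bar>g x\<bar>"
      by (metis abs_ge_self abs_mult)
    also have "\<dots> \<le> \<bar>f x\<bar> * (M * \<bar>f x\<bar>)"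
      using bound[of x] x by (intro mult_left_mono) auto
    also have "\<dots> = M * (f x)\<^sup>2"
      by (simp add: power2_eq_square)
    finally have "2 * (f x * g x - M * (f x)\<^sup>2) * exp (- (2 * M) * x) \<le> 0"
      by (simp add: mult_le_0_iff)
    moreover have "(?F has_real_derivative 2 * (f x * g x - M * (f x)\<^sup>2) * exp (- (2 * M) * x)) (at x)"
      using df[of x] x by (auto intro!: derivative_eq_intros simp: algebra_simps power2_eq_square)
    ultimately show "\<exists>y. (?F has_real_derivative y) (at x) \<and> y \<le> 0"
      by blast
  qed
  then show ?thesis
    using \<open>f a = 0\<close> by (simp add: mult_le_0_iff)
qed

lemma zero_if_derivative_bound:
  fixes f g :: "real \<Rightarrow> real"
  assumes df: "\<And>x. x \<in> closed_segment a b \<Longrightarrow> (f has_real_derivative g x) (at x)"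
    and bound: "\<And>x. x \<in> closed_segment a b \<Longrightarrow> \<bar>g x\<bar> \<le> M * \<bar>f x\<bar>"
    and "f a = 0"
  shows "f b = 0"
proof (cases "a \<le> b")
  case True
  then show ?thesis
    using zero_forward_if_derivative_bound[of a b f g M] assms
    by (simp add: closed_segment_eq_real_ivl)
next
  case False
  have "f (- (- b)) = 0"
  proof (rule zero_forward_if_derivative_bound[where f = "\<lambda>x. f (- x)" and g = "\<lambda>x. - g (- x)"])
    show "- a \<le> - b" using False by simp
    fix x assume "x \<in> {- a..- b}"
    then have x: "- x \<in> closed_segment a b"
      using False by (auto simp: closed_segment_eq_real_ivl)
    show "((\<lambda>x. f (- x)) has_real_derivative - g (- x)) (at x)"
      using DERIV_chain2[where f = f and g = "\<lambda>t. - t" and x = x and s = UNIV,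
          OF df[OF x] DERIV_minus[OF DERIV_ident]]
      by simp
    show "\<bar>- g (- x)\<bar> \<le> M * \<bar>f (- x)\<bar>"
      using bound[OF x] by simp
  qed (use \<open>f a = 0\<close> in simp)
  then show ?thesis by simp
qed

text \<open>This differentiates the identity \<open>g * k = 0\<close> at a zero of \<open>g\<close>
  although \<open>k\<close> is only continuous: the difference quotient of \<open>g\<close> times
  \<open>k\<close> vanishes near \<open>z\<close> and tends to \<open>h * k z\<close>.\<close>

lemma derivative_factor_zero:
  fixes g k :: "real \<Rightarrow> real"
  assumes "open K" "z \<in> K" "(g has_real_derivative h) (at z)" "g z = 0"
    and "isCont k z" "\<And>t. t \<in> K \<Longrightarrow> g t * k t = 0"
  shows "h * k z = 0"
proof -
  have "((\<lambda>t. (g t - g z) / (t - z) * k t) \<longlongrightarrow> h * k z) (at z)"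
    using assms(3,5) by (intro tendsto_mult) (auto simp: has_field_derivative_iff isCont_def)
  moreover have "eventually (\<lambda>t. (g t - g z) / (t - z) * k t = 0) (at z)"
    using eventually_at_in_open'[OF assms(1,2)]
    by eventually_elim (use assms(4,6) in simp)
  ultimately show ?thesis
    using tendsto_unique[OF trivial_limit_at _ tendsto_eventually] by blast
qed

section \<open>The first-order equation with an even quartic right-hand side\<close>

text \<open>One normal form for all three equations: the coefficients are
  \<open>(a\<^sub>i, -b\<^sub>i, c\<^sub>i)\<close> for \<phi> and \<psi>, and
  \<open>(c\<^sub>3, b\<^sub>3, a\<^sub>3)\<close> for \<zeta>. In each case \<open>disc\<close>
  concerns \<open>b\<^sub>i^2 - a\<^sub>i c\<^sub>i\<close>, which neither the sign of
  \<open>b\<^sub>i\<close> nor exchanging \<open>a\<^sub>i\<close> and \<open>c\<^sub>i\<close>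
  affects.\<close>

locale quartic_ode =
  fixes K :: "real set" and f g h :: "real \<Rightarrow> real" and \<alpha> \<beta> \<gamma> :: real
  assumes K: "open K" "is_interval K" "0 \<in> K"
    and df: "\<And>x. x \<in> K \<Longrightarrow> (f has_real_derivative g x) (at x)"
    and dg: "\<And>x. x \<in> K \<Longrightarrow> (g has_real_derivative h x) (at x)"
    and ch: "continuous_on K h"
    and nonconst: "\<not> f constant_on K"
    and ode: "\<And>x. x \<in> K \<Longrightarrow> (g x)\<^sup>2 = \<alpha> + 2 * \<beta> * f x ^ 2 + \<gamma> * f x ^ 4"
    and disc: "\<beta>\<^sup>2 - \<alpha> * \<gamma> \<noteq> 0"
begin

lemma cf: "continuous_on K f"
  using df by (meson DERIV_isCont continuous_at_imp_continuous_on)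

lemma segment_subset: "x \<in> K \<Longrightarrow> y \<in> K \<Longrightarrow> closed_segment x y \<subseteq> K"
  using K(2) by (simp add: closed_segment_subset is_interval_convex)

text \<open>A zero of \<open>f\<close> that is critical is a double root of the quartic, so \<open>f\<close> would vanish
  identically by a Gronwall estimate.\<close>

lemma nonzero_at_critical:
  assumes z: "z \<in> K" "g z = 0"
  shows "f z \<noteq> 0"
proof
  assume fz: "f z = 0"
  then have \<alpha>: "\<alpha> = 0" using ode[OF z(1)] z(2) by simp
  have "f y = 0" if y: "y \<in> K" for y
  proof -
    let ?k = "\<lambda>x. \<bar>2 * \<beta> + \<gamma> * f x ^ 2\<bar>"
    have sub: "closed_segment z y \<subseteq> K" using segment_subset z y by blast
    have "compact (?k ` closed_segment z y)"
      by (intro compact_continuous_image continuous_intros compact_segment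
          continuous_on_subset[OF cf sub])
    then have "bounded (?k ` closed_segment z y)" by (rule compact_imp_bounded)
    then obtain B where "\<forall>v \<in> ?k ` closed_segment z y. norm v \<le> B"
      unfolding bounded_iff by blast
    then have B: "?k x \<le> B" if "x \<in> closed_segment z y" for x
      using that by auto
    show ?thesis
    proof (rule zero_if_derivative_bound[of z y f g "sqrt B"])
      show "(f has_real_derivative g x) (at x)" if "x \<in> closed_segment z y" for x
        using df sub that by blast
      show "\<bar>g x\<bar> \<le> sqrt B * \<bar>f x\<bar>" if x: "x \<in> closed_segment z y" for x
      proof -
        have "(g x)\<^sup>2 = (2 * \<beta> + \<gamma> * f x ^ 2) * (f x)\<^sup>2"
          using ode[of x] sub x \<alpha> by (auto simp: algebra_simps power2_eq_square power4_eq_xxxx)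
        also have "\<dots> \<le> B * (f x)\<^sup>2"
          using B[OF x] by (intro mult_right_mono) auto
        finally have "sqrt ((g x)\<^sup>2) \<le> sqrt (B * (f x)\<^sup>2)"
          by (rule real_sqrt_le_mono)
        then show ?thesis by (simp add: real_sqrt_mult)
      qed
    qed (fact fz)
  qed
  then show False using nonconst by (auto simp: constant_on_def)
qed

text \<open>Completing the square: \<gamma> times the quartic is \<open>(\<beta> + \<gamma> * f^2)^2
  - (\<beta>^2 - \<alpha> * \<gamma>)\<close>, and the quartic vanishes at a critical point. So the
  factor that will govern the second derivative there is nonzero and known up to sign.\<close>

lemma critical_value:
  assumes z: "z \<in> K" "g z = 0"
  shows "(\<beta> + \<gamma> * (f z)\<^sup>2)\<^sup>2 = \<beta>\<^sup>2 - \<alpha> * \<gamma>"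
proof -
  have "\<alpha> + 2 * \<beta> * (f z)\<^sup>2 + \<gamma> * f z ^ 4 = 0" using ode[OF z(1)] z(2) by simp
  then have "\<gamma> * (\<alpha> + 2 * \<beta> * (f z)\<^sup>2 + \<gamma> * f z ^ 4) = 0" by simp
  then show ?thesis by (simp add: power2_eq_square power4_eq_xxxx algebra_simps)
qed

text \<open>Differentiating the first-order equation only gives this up to a factor \<open>g\<close>; at a zero of
  \<open>g\<close> the second derivative could a priori also vanish. The two alternatives define disjoint
  closed sets, and connectedness excludes the second one.\<close>

lemma second_order:
  assumes "x \<in> K"
  shows "h x = 2 * \<beta> * f x + 2 * \<gamma> * f x ^ 3"
proof -
  let ?R = "\<lambda>x. 2 * \<beta> * f x + 2 * \<gamma> * f x ^ 3"
  define B where "B = {x \<in> K. h x - ?R x = 0}"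
  define C where "C = {x \<in> K. g x = 0} \<inter> {x \<in> K. h x = 0}"
  have factor: "g x * (h x - ?R x) = 0" if x: "x \<in> K" for x
  proof -
    have "((\<lambda>t. (g t)\<^sup>2) has_real_derivative 2 * g x * h x) (at x)"
      using dg[OF x] by (auto intro!: derivative_eq_intros)
    moreover have "((\<lambda>t. (g t)\<^sup>2) has_real_derivative 2 * g x * ?R x) (at x)"
    proof (rule has_field_derivative_transform_within_open[OF _ K(1) x])
      show "((\<lambda>t. \<alpha> + 2 * \<beta> * f t ^ 2 + \<gamma> * f t ^ 4) has_real_derivative 2 * g x * ?R x) (at x)"
        using df[OF x] by (auto intro!: derivative_eq_intros
            simp: algebra_simps eval_nat_numeral)
    qed (simp add: ode)
    ultimately have "2 * g x * h x = 2 * g x * ?R x" by (rule DERIV_unique)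
    then show ?thesis by (simp add: algebra_simps)
  qed
  have cg: "continuous_on K g"
    using dg by (meson DERIV_isCont continuous_at_imp_continuous_on)
  have ck: "continuous_on K (\<lambda>x. h x - ?R x)"
    by (intro continuous_intros cf ch)
  have "closedin (top_of_set K) B" "closedin (top_of_set K) C"
    unfolding B_def C_def
    by (intro closedin_Int continuous_closedin_preimage_constant ck cg ch)+
  moreover have "B \<inter> C = {}"
  proof (rule ccontr)
    assume "B \<inter> C \<noteq> {}"
    then obtain z where z: "z \<in> K" "g z = 0" "h z = 0" "?R z = 0"
      by (auto simp: B_def C_def)
    \<comment> \<open>At a common point \<open>f\<close> is nonzero because the point is critical,
      and the square of the other factor is the nonzero discriminant.\<close>
    from z(4) have "2 * f z * (\<beta> + \<gamma> * (f z)\<^sup>2) = 0"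
      by (simp add: algebra_simps power2_eq_square power3_eq_cube)
    then show False
      using nonzero_at_critical[OF z(1,2)] critical_value[OF z(1,2)] disc by simp
  qed
  moreover have "B \<union> C = K"
  proof -
    have "x \<in> B \<union> C" if x: "x \<in> K" for x
    proof (cases "g x = 0")
      case True
      have "isCont (\<lambda>x. h x - ?R x) x"
        using ck K(1) x continuous_on_eq_continuous_at by blast
      \<comment> \<open>The factor \<open>g x\<close> cannot be cancelled here, so the factored
        identity is differentiated once more.\<close>
      then have "h x * (h x - ?R x) = 0"
        using derivative_factor_zero[OF K(1) x dg[OF x] True _ factor] by blast
      then show ?thesis using True x by (auto simp: B_def C_def)
    next
      case False
      then show ?thesis using factor[OF x] x by (auto simp: B_def)
    qed
    then show ?thesis by (auto simp: B_def C_def)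
  qed
  moreover have "connected K" using K(2) by (rule is_interval_connected)
  ultimately consider "B = {}" | "C = {}"
    unfolding connected_closedin_eq by blast
  then show ?thesis
  proof cases
    case 1
    then have "g x = 0" if "x \<in> K" for x
      using \<open>B \<union> C = K\<close> that by (auto simp: C_def)
    then have "f constant_on K"
      using has_field_derivative_zero_constant[of K f] K(2) df
      by (metis constant_on_def has_field_derivative_at_within is_interval_convex)
    then show ?thesis using nonconst by blast
  next
    case 2
    then show ?thesis using \<open>B \<union> C = K\<close> assms by (auto simp: B_def)
  qed
qed

text \<open>The second-order equation expresses \<open>h\<close> through \<open>f\<close>, so
  \<open>h\<close> is itself differentiable and the third derivative of \<open>f\<close> is bounded
  near 0. This gives a cubic remainder; the quadratic coefficient is half of
  \<open>h 0\<close>.\<close>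

lemma taylor:
  assumes g0: "g 0 = 0"
  obtains C d where "0 < d" "0 \<le> C"
    "\<And>x. \<bar>x\<bar> < d \<Longrightarrow> \<bar>f x - f 0 - f 0 * (\<beta> + \<gamma> * (f 0)\<^sup>2) * x\<^sup>2\<bar> \<le> C * \<bar>x\<bar> ^ 3"
proof -
  obtain d where d: "d > 0" "cball 0 d \<subseteq> K"
    using K open_contains_cball by blast
  have inK: "t \<in> K" if "\<bar>t\<bar> \<le> d" for t
    using d(2) that by (auto simp: dist_norm)
  let ?T = "\<lambda>t. (2 * \<beta> + 6 * \<gamma> * (f t)\<^sup>2) * g t"
  have cg: "continuous_on K g"
    using dg by (meson DERIV_isCont continuous_at_imp_continuous_on)
  have "compact (?T ` cball 0 d)"
    by (intro compact_continuous_image continuous_intros compact_cball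
        continuous_on_subset[OF cf d(2)] continuous_on_subset[OF cg d(2)])
  then have "bounded (?T ` cball 0 d)" by (rule compact_imp_bounded)
  then obtain M where "\<forall>v \<in> ?T ` cball 0 d. norm v \<le> M"
    unfolding bounded_iff by blast
  then have M: "\<bar>?T t\<bar> \<le> M" if "\<bar>t\<bar> \<le> d" for t
    using that by (auto simp: dist_norm)
  have dh: "(h has_real_derivative ?T t) (at t)" if "t \<in> K" for t
  proof (rule has_field_derivative_transform_within_open[OF _ K(1) that])
    show "((\<lambda>t. 2 * \<beta> * f t + 2 * \<gamma> * f t ^ 3) has_real_derivative ?T t) (at t)"
      using df[OF that] by (auto intro!: derivative_eq_intros simp: algebra_simps power2_eq_square)
  qed (simp add: second_order)
  \<comment> \<open>The successive derivatives for Maclaurin's formula. Only orders below 3 get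
    differentiated, so the value from index 3 on may be constant in \<open>n\<close>.\<close>
  define D where "D = (\<lambda>n::nat. if n = 0 then f else if n = 1 then g else if n = 2 then h else ?T)"
  have h0: "h 0 = 2 * f 0 * (\<beta> + \<gamma> * (f 0)\<^sup>2)"
    using second_order[OF K(3)] by (simp add: algebra_simps power2_eq_square power3_eq_cube)
  show thesis
  proof
    show "0 < d" "0 \<le> \<bar>M\<bar> / 6" using d by auto
    fix x :: real assume x: "\<bar>x\<bar> < d"
    have "\<exists>t. \<bar>t\<bar> \<le> \<bar>x\<bar> \<and> f x = (\<Sum>m<3. D m 0 / fact m * x ^ m) + D 3 t / fact 3 * x ^ 3"
    proof (rule Maclaurin_bi_le)
      show "D 0 = f" by (simp add: D_def)
      show "\<forall>m t. m < 3 \<and> \<bar>t\<bar> \<le> \<bar>x\<bar> \<longrightarrow> (D m has_real_derivative D (Suc m) t) (at t)"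
      proof (intro allI impI)
        fix m :: nat and t :: real assume "m < 3 \<and> \<bar>t\<bar> \<le> \<bar>x\<bar>"
        then have "t \<in> K" "m = 0 \<or> m = 1 \<or> m = 2" using x inK by auto
        then show "(D m has_real_derivative D (Suc m) t) (at t)"
          using df dg dh by (auto simp: D_def)
      qed
    qed
    then obtain t where t: "\<bar>t\<bar> \<le> \<bar>x\<bar>"
      "f x = (\<Sum>m<3. D m 0 / fact m * x ^ m) + D 3 t / fact 3 * x ^ 3" by blast
    have "f x = f 0 + f 0 * (\<beta> + \<gamma> * (f 0)\<^sup>2) * x\<^sup>2 + ?T t / 6 * x ^ 3"
      using t(2) g0 h0 by (simp add: D_def eval_nat_numeral)
    then have "\<bar>f x - f 0 - f 0 * (\<beta> + \<gamma> * (f 0)\<^sup>2) * x\<^sup>2\<bar> = \<bar>?T t\<bar> / 6 * \<bar>x\<bar> ^ 3"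
      by (simp add: abs_mult power_abs)
    also have "\<dots> \<le> \<bar>M\<bar> / 6 * \<bar>x\<bar> ^ 3"
      using M[of t] t(1) x by (intro mult_right_mono divide_right_mono) auto
    finally show "\<bar>f x - f 0 - f 0 * (\<beta> + \<gamma> * (f 0)\<^sup>2) * x\<^sup>2\<bar> \<le> \<bar>M\<bar> / 6 * \<bar>x\<bar> ^ 3" .
  qed
qed

text \<open>By \<open>side\<close>, \<open>f 0 * s * (f x - f 0)\<close> has a local minimum at 0,
  so 0 is critical and the quadratic coefficient is \<open>f 0 * s\<close> or its negative. The
  negative choice would make that expression negative at small nonzero \<open>x\<close>, where the
  quadratic term dominates the remainder.\<close>

lemma taylor_at_one_sided_extremum:
  assumes s: "s\<^sup>2 = \<beta>\<^sup>2 - \<alpha> * \<gamma>" and f0: "f 0 \<noteq> 0"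
    and side: "eventually (\<lambda>x. 0 \<le> f 0 * s * (f x - f 0)) (nhds 0)"
  obtains C d where "0 < d" "0 \<le> C"
    "\<And>x. \<bar>x\<bar> < d \<Longrightarrow> \<bar>f x - f 0 - f 0 * s * x\<^sup>2\<bar> \<le> C * \<bar>x\<bar> ^ 3"
proof -
  have s0: "s \<noteq> 0" using s disc by auto
  obtain e where e: "e > 0" "\<And>x. \<bar>x\<bar> < e \<Longrightarrow> 0 \<le> f 0 * s * (f x - f 0)"
    using side unfolding eventually_nhds_metric by (auto simp: dist_norm)
  have "f 0 * s * g 0 = 0"
  proof (rule DERIV_local_min[OF _ e(1)])
    show "((\<lambda>x. f 0 * s * (f x - f 0)) has_real_derivative f 0 * s * g 0) (at 0)"
      using df[OF K(3)] by (auto intro!: derivative_eq_intros)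
    show "\<forall>y. \<bar>0 - y\<bar> < e \<longrightarrow> f 0 * s * (f 0 - f 0) \<le> f 0 * s * (f y - f 0)"
      using e(2) by simp
  qed
  then have g0: "g 0 = 0" using f0 s0 by simp
  let ?r = "\<beta> + \<gamma> * (f 0)\<^sup>2"
  obtain C d where C: "0 < d" "0 \<le> C"
    "\<And>x. \<bar>x\<bar> < d \<Longrightarrow> \<bar>f x - f 0 - f 0 * ?r * x\<^sup>2\<bar> \<le> C * \<bar>x\<bar> ^ 3"
    using taylor[OF g0] by blast
  have "?r\<^sup>2 = s\<^sup>2" using critical_value[OF K(3) g0] s by simp
  then consider "?r = s" | "?r = - s" by (auto simp: power2_eq_iff)
  then have "?r = s"
  proof cases
    case 2
    define A where "A = \<bar>f 0 * s\<bar>"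
    have A: "A > 0" using f0 s0 by (simp add: A_def)
    \<comment> \<open>A positive test point inside both neighbourhoods with
      \<open>C * x < A\<close>. The halving makes the inequalities strict, and \<open>C + 1\<close>
      allows for \<open>C = 0\<close>.\<close>
    define x where "x = min (min d e) (A / (C + 1)) / 2"
    have "A / (C + 1) > 0" using A C by simp
    then have x: "x > 0" "x < d" "x < e"
      using C(1) e(1) by (auto simp: x_def min_def)
    have "2 * x \<le> A / (C + 1)" by (simp add: x_def)
    then have "x < A / (C + 1)" using x(1) by linarith
    then have "C * x < A"
      using C x by (simp add: field_simps)
    define E where "E = f x - f 0 - f 0 * ?r * x\<^sup>2"
    have E: "\<bar>E\<bar> \<le> C * x ^ 3" using C(3)[of x] x by (simp add: E_def)
    have "0 \<le> f 0 * s * (f x - f 0)" using e(2)[of x] x by simp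
    also have "f x - f 0 = E - f 0 * s * x\<^sup>2" using 2 by (simp add: E_def)
    also have "f 0 * s * (E - f 0 * s * x\<^sup>2) = f 0 * s * E - A\<^sup>2 * x\<^sup>2"
      by (simp add: A_def algebra_simps power2_eq_square)
    also have "f 0 * s * E \<le> A * (C * x ^ 3)"
      using abs_ge_self[of "f 0 * s * E"] mult_left_mono[OF E, of A] A
      by (simp add: A_def abs_mult)
    finally have "0 \<le> A * x\<^sup>2 * (C * x - A)"
      by (simp add: algebra_simps power2_eq_square power3_eq_cube)
    moreover have "A * x\<^sup>2 * (C * x - A) < 0"
      using A x \<open>C * x < A\<close> by (simp add: mult_less_0_iff)
    ultimately show ?thesis by simp
  qed
  then show thesis using that[of d C] C by simp
qed

end

section \<open>From the square of \<open>u\<close> to \<open>u\<close> itself\<close>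

text \<open>Near 0 the cubic terms are absorbed by the squares, so \<open>\<bar>u p\<bar>\<close> is
  comparable to \<open>norm p\<close> and factoring the difference of squares gives the estimate for
  \<open>\<bar>u p\<bar>\<close>. In particular \<open>u\<close> has no zero on a punctured ball,
  which is connected in dimension at least two, so one sign \<delta> serves all points.\<close>

lemma norm_asymptotics_if_square_asymptotics:
  fixes u :: "'a::euclidean_space \<Rightarrow> real"
  assumes dim: "2 \<le> DIM('a)" and "open U" "0 \<in> U" and cu: "continuous_on U u" and "u 0 = 0"
    and ev: "eventually (\<lambda>p. \<bar>(u p)\<^sup>2 - (norm p)\<^sup>2\<bar> \<le> C * (\<bar>u p\<bar> ^ 3 + norm p ^ 3)) (nhds 0)"
  shows "\<exists>\<delta>\<in>{1, -1}. (\<lambda>p. u p - \<delta> * norm p) \<in> O[at 0](\<lambda>p. (norm p)\<^sup>2)"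
proof -
  define c where "c = max C 1"
  have c: "c \<ge> 1" "C \<le> c" by (auto simp: c_def)
  have "isCont u 0"
    using assms continuous_on_eq_continuous_at by blast
  then have "(u \<longlongrightarrow> 0) (nhds 0)"
    using \<open>u 0 = 0\<close> by (simp add: isCont_def tendsto_nhds_iff)
  then have "eventually (\<lambda>p. \<bar>u p\<bar> < 1 / (18 * c)) (nhds 0)"
    using order_tendstoD(2)[OF tendsto_rabs, of u 0 "nhds 0" "1 / (18 * c)"] c by simp
  moreover have "eventually (\<lambda>p. p \<in> U) (nhds 0)"
    using assms eventually_nhds_in_open by blast
  moreover have "eventually (\<lambda>p. norm p < 1 / (18 * c)) (nhds (0::'a))"
    using c by (auto simp: eventually_nhds_metric intro!: exI[of _ "1 / (18 * c)"])
  ultimately have "eventually (\<lambda>p. p \<in> U \<and> \<bar>u p\<bar> < 1 / (18 * c) \<and> norm p < 1 / (18 * c) \<and>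
      \<bar>(u p)\<^sup>2 - (norm p)\<^sup>2\<bar> \<le> C * (\<bar>u p\<bar> ^ 3 + norm p ^ 3)) (nhds 0)"
    using ev by eventually_elim blast
  then obtain d where d: "d > 0" and near: "\<And>p. norm p < d \<Longrightarrow> p \<in> U \<and> \<bar>u p\<bar> < 1 / (18 * c) \<and>
      norm p < 1 / (18 * c) \<and> \<bar>(u p)\<^sup>2 - (norm p)\<^sup>2\<bar> \<le> C * (\<bar>u p\<bar> ^ 3 + norm p ^ 3)"
    unfolding eventually_nhds_metric by (auto simp: dist_norm)
  have bound: "\<bar>\<bar>u p\<bar> - norm p\<bar> \<le> 9 * c * (norm p)\<^sup>2 \<and> u p \<noteq> 0"
    if p: "norm p < d" "p \<noteq> 0" for p
  proof -
    define r v where "r = norm p" and "v = \<bar>u p\<bar>"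
    have r: "r > 0" "18 * (c * r) < 1" and v: "v \<ge> 0" "18 * (c * v) < 1"
      using near[OF p(1)] p c by (auto simp: r_def v_def field_simps)
    have *: "\<bar>v\<^sup>2 - r\<^sup>2\<bar> \<le> c * (v ^ 3 + r ^ 3)"
    proof -
      have "\<bar>v\<^sup>2 - r\<^sup>2\<bar> \<le> C * (v ^ 3 + r ^ 3)"
        using near[OF p(1)] by (simp add: r_def v_def)
      also have "\<dots> \<le> c * (v ^ 3 + r ^ 3)"
        using c r v by (intro mult_right_mono) auto
      finally show ?thesis .
    qed
    \<comment> \<open>The threshold \<open>1 / (18 * c)\<close> makes each cubic term at most 1/18
      of the square. Then \<open>17 * v^2 \<le> 19 * r^2\<close>, amply enough for
      \<open>v \<le> 2 * r\<close>.\<close>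
    have cv: "c * v ^ 3 \<le> v\<^sup>2 / 18" and cr: "c * r ^ 3 \<le> r\<^sup>2 / 18"
      using mult_right_mono[of "18 * (c * v)" 1 "v\<^sup>2"] mult_right_mono[of "18 * (c * r)" 1 "r\<^sup>2"] r v
      by (simp_all add: power2_eq_square power3_eq_cube algebra_simps)
    have v2: "v\<^sup>2 \<le> (2 * r)\<^sup>2"
      using * cv cr by (simp add: algebra_simps power2_eq_square abs_le_iff)
    then have "v \<le> 2 * r"
      using r by (intro power2_le_imp_le[OF v2]) auto
    then have "v ^ 3 \<le> (2 * r) ^ 3"
      using v by (intro power_mono)
    \<comment> \<open>The constant 9 is \<open>2^3 + 1\<close>. Below, one factor \<open>r\<close>
      is cancelled using \<open>r \<le> v + r\<close>.\<close>
    then have "c * (v ^ 3 + r ^ 3) \<le> c * (9 * r ^ 3)"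
      using c by (intro mult_left_mono) (auto simp: power_mult_distrib)
    moreover have "\<bar>v\<^sup>2 - r\<^sup>2\<bar> = \<bar>v - r\<bar> * (v + r)"
      using r v by (simp add: square_diff_square_factored power2_eq_square abs_mult)
    moreover have "c * (9 * r ^ 3) = (9 * c * r\<^sup>2) * r"
      by (simp add: power2_eq_square power3_eq_cube)
    ultimately have "\<bar>v - r\<bar> * (v + r) \<le> (9 * c * r\<^sup>2) * r"
      using * by linarith
    moreover have "\<bar>v - r\<bar> * r \<le> \<bar>v - r\<bar> * (v + r)"
      using v by (intro mult_left_mono) auto
    ultimately have "\<bar>v - r\<bar> * r \<le> (9 * c * r\<^sup>2) * r" by linarith
    then have "\<bar>v - r\<bar> \<le> 9 * c * r\<^sup>2"
      using r by simp
    moreover have "v \<noteq> 0"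
    proof
      assume "v = 0"
      then have "r\<^sup>2 \<le> c * r ^ 3" using * by simp
      moreover have "r\<^sup>2 > 0" using r by simp
      ultimately show False using cr by linarith
    qed
    ultimately show ?thesis by (auto simp: r_def v_def)
  qed
  let ?S = "ball (0::'a) d - {0}"
  have "connected ?S"
    using dim by (simp add: connected_punctured_ball)
  moreover have "continuous_on ?S u"
    by (rule continuous_on_subset[OF cu]) (use near in auto)
  ultimately have conn: "connected (u ` ?S)"
    by (rule connected_continuous_image[rotated])
  have nz: "u p \<noteq> 0" if "p \<in> ?S" for p
    using bound[of p] that by simp
  have "(\<forall>p\<in>?S. u p > 0) \<or> (\<forall>p\<in>?S. u p < 0)"
  proof (rule ccontr)
    assume "\<not> ?thesis"
    then obtain p q where "p \<in> ?S" "q \<in> ?S" and *: "u p \<le> 0" "0 \<le> u q"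
      by (meson not_less)
    then have "{u p..u q} \<subseteq> u ` ?S"
      using connected_contains_Icc[OF conn] by blast
    then have "0 \<in> u ` ?S" using * by auto
    then show False using nz by force
  qed
  then obtain \<delta> :: real where \<delta>: "\<delta> \<in> {1, -1}" "\<And>p. p \<in> ?S \<Longrightarrow> u p = \<delta> * \<bar>u p\<bar>"
  proof
    assume "\<forall>p\<in>?S. u p > 0"
    then show thesis by (intro that[of 1]) (auto simp: abs_of_pos)
  next
    assume "\<forall>p\<in>?S. u p < 0"
    then show thesis by (intro that[of "-1"]) (auto simp: abs_of_neg)
  qed
  have "(\<lambda>p. u p - \<delta> * norm p) \<in> O[at 0](\<lambda>p. (norm p)\<^sup>2)"
  proof (rule bigoI)
    have "norm (u p - \<delta> * norm p) \<le> 9 * c * norm ((norm p)\<^sup>2)" if "p \<in> ?S" for p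
    proof -
      have "u p - \<delta> * norm p = \<delta> * (\<bar>u p\<bar> - norm p)"
        using \<delta>(2)[OF that] by (simp add: algebra_simps)
      then have "norm (u p - \<delta> * norm p) = \<bar>\<bar>u p\<bar> - norm p\<bar>"
        using \<delta>(1) by (auto simp: abs_mult)
      then show ?thesis using bound[of p] that by simp
    qed
    then show "eventually (\<lambda>p. norm (u p - \<delta> * norm p) \<le> 9 * c * norm ((norm p)\<^sup>2)) (at 0)"
      using d by (auto simp: eventually_at intro!: exI[of _ d])
  qed
  then show ?thesis using \<delta>(1) by blast
qed

section \<open>Expansion of the product\<close>

text \<open>Because both factors carry the same \<open>s\<close>, their quadratic terms add up to
  \<open>p * q * s * (x^2 + y^2)\<close>. What remains are the two Taylor errors and a term in
  \<open>x^2 * y^2\<close>, all of order \<open>r^3\<close>.\<close>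

lemma product_taylor_bound:
  fixes p q s C D x y X Y :: real
  assumes X: "\<bar>X - p - p * s * x\<^sup>2\<bar> \<le> C * \<bar>x\<bar> ^ 3" and Y: "\<bar>Y - q - q * s * y\<^sup>2\<bar> \<le> D * \<bar>y\<bar> ^ 3"
    and "0 \<le> C" "0 \<le> D" and r: "r\<^sup>2 = x\<^sup>2 + y\<^sup>2" "0 \<le> r" "r \<le> 1"
  shows "\<bar>X * Y - p * q - p * q * s * r\<^sup>2\<bar>
    \<le> (C * (\<bar>q\<bar> + \<bar>q * s\<bar> + D) + (\<bar>p\<bar> + \<bar>p * s\<bar>) * D + \<bar>p * q\<bar> * s\<^sup>2) * r ^ 3"
proof -
  have x: "\<bar>x\<bar> \<le> r" and y: "\<bar>y\<bar> \<le> r"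
    by (simp_all add: r(1) flip: power2_le_iff_abs_le[OF r(2)])
  have x1: "\<bar>x\<bar> \<le> 1" and y1: "\<bar>y\<bar> \<le> 1" using x y r by auto
  have x2: "x\<^sup>2 \<le> 1" and y2: "y\<^sup>2 \<le> 1" and y3: "\<bar>y\<bar> ^ 3 \<le> 1"
    using x1 y1 by (simp_all add: abs_square_le_1 power_le_one)
  have x3r: "\<bar>x\<bar> ^ 3 \<le> r ^ 3" and y3r: "\<bar>y\<bar> ^ 3 \<le> r ^ 3"
    using power_mono[OF x, of 3] power_mono[OF y, of 3] by simp_all
  define E F where "E = X - p - p * s * x\<^sup>2" and "F = Y - q - q * s * y\<^sup>2"
  have E: "\<bar>E\<bar> \<le> C * r ^ 3" and F: "\<bar>F\<bar> \<le> D * r ^ 3" and F1: "\<bar>F\<bar> \<le> D"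
    using X Y mult_left_mono[OF x3r \<open>0 \<le> C\<close>] mult_left_mono[OF y3r \<open>0 \<le> D\<close>]
      mult_left_mono[OF y3 \<open>0 \<le> D\<close>] unfolding E_def F_def by linarith+
  have "Y = q + q * s * y\<^sup>2 + F" by (simp add: F_def)
  moreover have "\<bar>q * s * y\<^sup>2\<bar> \<le> \<bar>q * s\<bar>"
    using mult_left_mono[OF y2, of "\<bar>q * s\<bar>"] by (simp add: abs_mult)
  ultimately have Yb: "\<bar>Y\<bar> \<le> \<bar>q\<bar> + \<bar>q * s\<bar> + D"
    using F1 by linarith
  have "\<bar>p * s * x\<^sup>2\<bar> \<le> \<bar>p * s\<bar>"
    using mult_left_mono[OF x2, of "\<bar>p * s\<bar>"] by (simp add: abs_mult)
  then have Pb: "\<bar>p + p * s * x\<^sup>2\<bar> \<le> \<bar>p\<bar> + \<bar>p * s\<bar>" by linarith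
  \<comment> \<open>This term is of fourth order; bounding one factor \<open>\<bar>y\<bar>\<close>
    by 1 brings it to the common cubic form.\<close>
  have "\<bar>x * x * (y * y)\<bar> \<le> r * r * (r * 1)"
    unfolding abs_mult using x y y1 r by (intro mult_mono) auto
  then have xy: "x\<^sup>2 * y\<^sup>2 \<le> r ^ 3"
    by (simp add: power2_eq_square power3_eq_cube)
  \<comment> \<open>With \<open>X = P + E\<close> and \<open>Y = Q + F\<close>, the product is
    \<open>E * Y + P * F + P * Q\<close>; expanding \<open>P * Q\<close> gives the last
    term.\<close>
  have "X * Y - p * q - p * q * s * r\<^sup>2 = E * Y + (p + p * s * x\<^sup>2) * F + p * q * s\<^sup>2 * (x\<^sup>2 * y\<^sup>2)"
    unfolding r(1) E_def F_def by (simp add: algebra_simps power2_eq_square)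
  also have "\<bar>\<dots>\<bar> \<le> \<bar>E\<bar> * \<bar>Y\<bar> + \<bar>p + p * s * x\<^sup>2\<bar> * \<bar>F\<bar> + \<bar>p * q\<bar> * s\<^sup>2 * (x\<^sup>2 * y\<^sup>2)"
  proof -
    have "\<bar>p * q * s\<^sup>2 * (x\<^sup>2 * y\<^sup>2)\<bar> = \<bar>p * q\<bar> * s\<^sup>2 * (x\<^sup>2 * y\<^sup>2)"
      by (simp add: abs_mult)
    then show ?thesis
      using abs_mult[of E Y] abs_mult[of "p + p * s * x\<^sup>2" F] by linarith
  qed
  also have "\<dots> \<le> (C * r ^ 3) * (\<bar>q\<bar> + \<bar>q * s\<bar> + D) + (\<bar>p\<bar> + \<bar>p * s\<bar>) * (D * r ^ 3)
      + \<bar>p * q\<bar> * s\<^sup>2 * r ^ 3"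
  proof (intro add_mono)
    show "\<bar>E\<bar> * \<bar>Y\<bar> \<le> (C * r ^ 3) * (\<bar>q\<bar> + \<bar>q * s\<bar> + D)"
      using \<open>0 \<le> C\<close> r(2) by (intro mult_mono[OF E Yb]) simp_all
    show "\<bar>p + p * s * x\<^sup>2\<bar> * \<bar>F\<bar> \<le> (\<bar>p\<bar> + \<bar>p * s\<bar>) * (D * r ^ 3)"
      by (intro mult_mono[OF Pb F]) simp_all
    show "\<bar>p * q\<bar> * s\<^sup>2 * (x\<^sup>2 * y\<^sup>2) \<le> \<bar>p * q\<bar> * s\<^sup>2 * r ^ 3"
      by (intro mult_left_mono[OF xy]) simp
  qed
  finally show ?thesis by (simp add: algebra_simps)
qed

lemma C2_on_quartic_ode:
  fixes f :: "real \<Rightarrow> real"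
  assumes "open K" "is_interval K" "0 \<in> K" "C2_on K f" "\<not> f constant_on K"
    and "\<And>x. x \<in> K \<Longrightarrow> (deriv f x)\<^sup>2 = \<alpha> + 2 * \<beta> * f x ^ 2 + \<gamma> * f x ^ 4"
    and "\<beta>\<^sup>2 - \<alpha> * \<gamma> \<noteq> 0"
  shows "\<exists>g h. quartic_ode K f g h \<alpha> \<beta> \<gamma> \<and> g 0 = deriv f 0"
proof -
  obtain g h where *: "\<And>x. x \<in> K \<Longrightarrow> (f has_real_derivative g x) (at x)"
    "\<And>x. x \<in> K \<Longrightarrow> (g has_real_derivative h x) (at x)" "continuous_on K h"
    using C2_on_real_derivatives[OF assms(4)] by blast
  have "deriv f x = g x" if "x \<in> K" for x
    using *(1)[OF that] by (rule DERIV_imp_deriv)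
  then have "quartic_ode K f g h \<alpha> \<beta> \<gamma>"
    using assms * by unfold_locales simp_all
  then show ?thesis
    using \<open>\<And>x. x \<in> K \<Longrightarrow> deriv f x = g x\<close>[OF assms(3)] by metis
qed

section \<open>Comparison of the expansions of \<zeta>(u) and of the product of \<phi> and
  \<psi>\<close>

theorem theorem6:
  fixes a b c :: "real^3"
    and \<phi> \<psi> \<zeta> :: "real \<Rightarrow> real"
    and I J K :: "real set"
    and u :: "real \<times> real \<Rightarrow> real"
    and U :: "(real \<times> real) set"
  assumes "generating (coeff_matrix a b c)"
    and "discriminant a b c \<noteq> 0"
    and "open I" "is_interval I" "0 \<in> I" "C2_on I \<phi>" "\<not> \<phi> constant_on I"
    and "open J" "is_interval J" "0 \<in> J" "C2_on J \<psi>" "\<not> \<psi> constant_on J"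
    and "open K" "is_interval K" "0 \<in> K" "C2_on K \<zeta>" "\<not> \<zeta> constant_on K"
    and "\<And>x. x \<in> I \<Longrightarrow> (deriv \<phi> x)\<^sup>2 = a $ 1 - 2 * b $ 1 * \<phi> x ^ 2 + c $ 1 * \<phi> x ^ 4"
    and "\<And>y. y \<in> J \<Longrightarrow> (deriv \<psi> y)\<^sup>2 = a $ 2 - 2 * b $ 2 * \<psi> y ^ 2 + c $ 2 * \<psi> y ^ 4"
    and "\<And>z. z \<in> K \<Longrightarrow> (deriv \<zeta> z)\<^sup>2 = c $ 3 + 2 * b $ 3 * \<zeta> z ^ 2 + a $ 3 * \<zeta> z ^ 4"
    and "open U" "(0, 0) \<in> U" "continuous_on U u" "u (0, 0) = 0"
    and "\<And>x y. (x, y) \<in> U \<Longrightarrow>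
           x \<in> I \<and> y \<in> J \<and> u (x, y) \<in> K \<and> \<zeta> (u (x, y)) = \<phi> x * \<psi> y"
    and "isolated_nonremovable_singularity \<phi> \<psi> \<zeta> u (0, 0)"
  shows "\<exists>\<delta>\<in>{1, -1}.
           (\<lambda>(x, y). u (x, y) - \<delta> * sqrt (x\<^sup>2 + y\<^sup>2)) \<in> O[at (0, 0)](\<lambda>(x, y). x\<^sup>2 + y\<^sup>2)"
proof -
  have disc: "(b $ i)\<^sup>2 - a $ i * c $ i \<noteq> 0" for i
    using discriminant_eq[OF assms(1)] assms(2) by metis
  have disc_same: "(b $ i)\<^sup>2 - a $ i * c $ i = discriminant a b c" for i
    using discriminant_eq[OF assms(1)] by metis
  have "\<exists>g h. quartic_ode I \<phi> g h (a $ 1) (- b $ 1) (c $ 1) \<and> g 0 = deriv \<phi> 0"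
    using assms(18) disc[of 1] by (intro C2_on_quartic_ode assms(3-7)) simp_all
  then obtain g\<phi> h\<phi> where \<phi>: "quartic_ode I \<phi> g\<phi> h\<phi> (a $ 1) (- b $ 1) (c $ 1)"
    by blast
  have "\<exists>g h. quartic_ode J \<psi> g h (a $ 2) (- b $ 2) (c $ 2) \<and> g 0 = deriv \<psi> 0"
    using assms(19) disc[of 2] by (intro C2_on_quartic_ode assms(8-12)) simp_all
  then obtain g\<psi> h\<psi> where \<psi>: "quartic_ode J \<psi> g\<psi> h\<psi> (a $ 2) (- b $ 2) (c $ 2)"
    by blast
  have "\<exists>g h. quartic_ode K \<zeta> g h (c $ 3) (b $ 3) (a $ 3) \<and> g 0 = deriv \<zeta> 0"
    using assms(20) disc[of 3] by (intro C2_on_quartic_ode assms(13-17)) (simp_all add: mult.commute)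
  then obtain g\<zeta> h\<zeta> where \<zeta>: "quartic_ode K \<zeta> g\<zeta> h\<zeta> (c $ 3) (b $ 3) (a $ 3)"
    and "g\<zeta> 0 = deriv \<zeta> 0"
    by blast
  interpret \<phi>: quartic_ode I \<phi> g\<phi> h\<phi> "a $ 1" "- b $ 1" "c $ 1" by (fact \<phi>)
  interpret \<psi>: quartic_ode J \<psi> g\<psi> h\<psi> "a $ 2" "- b $ 2" "c $ 2" by (fact \<psi>)
  interpret \<zeta>: quartic_ode K \<zeta> g\<zeta> h\<zeta> "c $ 3" "b $ 3" "a $ 3" by (fact \<zeta>)
  have \<zeta>0: "g\<zeta> 0 = 0"
    using assms(26) \<open>u (0, 0) = 0\<close> \<open>g\<zeta> 0 = deriv \<zeta> 0\<close>
    by (simp add: isolated_nonremovable_singularity_def)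
  \<comment> \<open>Here \<open>s\<close> is normalised so that the second derivative of \<zeta> at
    0 is \<open>2 * \<zeta> 0 * s\<close>. Its square is the discriminant, and its sign is what has
    to be transferred to \<phi> and \<psi>.\<close>
  define p q s where "p = \<phi> 0" and "q = \<psi> 0" and "s = b $ 3 + a $ 3 * (\<zeta> 0)\<^sup>2"
  have w: "\<zeta> 0 = p * q"
    using assms(25)[of 0 0] assms(22,24) by (simp add: p_def q_def)
  have pq: "p \<noteq> 0" "q \<noteq> 0"
    using \<zeta>.nonzero_at_critical[OF \<zeta>.K(3) \<zeta>0] w by auto
  have s2: "s\<^sup>2 = discriminant a b c"
    using \<zeta>.critical_value[OF \<zeta>.K(3) \<zeta>0] disc_same[of 3] by (simp add: s_def mult.commute)
  then have s: "s \<noteq> 0" using assms(2) by auto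
  obtain C\<zeta> d\<zeta> where C\<zeta>: "0 < d\<zeta>" "0 \<le> C\<zeta>"
    "\<And>z. \<bar>z\<bar> < d\<zeta> \<Longrightarrow> \<bar>\<zeta> z - p * q - p * q * s * z\<^sup>2\<bar> \<le> C\<zeta> * \<bar>z\<bar> ^ 3"
    using \<zeta>.taylor[OF \<zeta>0] unfolding w s_def by blast
  define A where "A = \<bar>p * q * s\<bar>"
  have A: "A > 0" using pq s by (simp add: A_def)
  \<comment> \<open>For such \<open>z\<close> the remainder
    \<open>C\<zeta> * \<bar>z\<bar>^3\<close> is at most \<open>A * z^2\<close>, the size of the
    quadratic term, so it cannot reverse the sign.\<close>
  have \<zeta>_side: "0 \<le> p * q * s * (\<zeta> z - p * q)" if z: "\<bar>z\<bar> < d\<zeta>" "\<bar>z\<bar> < A / (C\<zeta> + 1)" for z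
  proof -
    define E where "E = \<zeta> z - p * q - p * q * s * z\<^sup>2"
    have "C\<zeta> * \<bar>z\<bar> \<le> (C\<zeta> + 1) * \<bar>z\<bar>" by (simp add: algebra_simps)
    also have "\<dots> \<le> A" using z(2) C\<zeta>(2) by (simp add: field_simps)
    finally have "C\<zeta> * \<bar>z\<bar> * z\<^sup>2 \<le> A * z\<^sup>2" by (intro mult_right_mono) auto
    then have "\<bar>E\<bar> \<le> A * z\<^sup>2"
      using C\<zeta>(3)[OF z(1)] by (simp add: E_def power2_eq_square power3_eq_cube mult.assoc)
    then have "A * \<bar>E\<bar> \<le> A * (A * z\<^sup>2)"
      using A by (intro mult_left_mono) auto
    moreover have "\<bar>p * q * s * E\<bar> = A * \<bar>E\<bar>"
      by (simp add: A_def abs_mult)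
    moreover have "A * (A * z\<^sup>2) = p * q * s * (p * q * s * z\<^sup>2)"
      by (simp add: A_def flip: mult.assoc power2_eq_square)
    ultimately have "0 \<le> p * q * s * E + p * q * s * (p * q * s * z\<^sup>2)" by linarith
    then show ?thesis by (simp add: E_def algebra_simps)
  qed
  have "isCont u (0, 0)"
    using assms(21-23) continuous_on_eq_continuous_at by blast
  then have u_lim: "(u \<longlongrightarrow> 0) (nhds (0, 0))"
    using assms(24) by (simp add: isCont_def tendsto_nhds_iff)
  have u_small: "eventually (\<lambda>m. \<bar>u m\<bar> < e) (nhds (0, 0))" if "e > 0" for e
    using order_tendstoD(2)[OF tendsto_rabs[OF u_lim], of e] that by simp
  have in_U: "eventually (\<lambda>m. m \<in> U) (nhds (0, 0))"
    using assms(21,22) eventually_nhds_in_open by blast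
  have small: "A / (C\<zeta> + 1) > 0" using A C\<zeta>(2) by simp
  \<comment> \<open>Continuity of \<open>u\<close> keeps its values in the range of
    \<open>\<zeta>_side\<close>, and the functional equation turns this into a sign condition on the
    product.\<close>
  have side: "eventually (\<lambda>(x, y). 0 \<le> p * q * s * (\<phi> x * \<psi> y - p * q)) (nhds (0, 0))"
    using in_U u_small[OF C\<zeta>(1)] u_small[OF small]
  proof eventually_elim
    case (elim m)
    then show ?case
      using \<zeta>_side[of "u m"] assms(25)[of "fst m" "snd m"] by (auto simp: split_beta)
  qed
  have axes: "((\<lambda>x::real. (x, 0::real)) \<longlongrightarrow> (0, 0)) (nhds 0)"
    "((\<lambda>y::real. (0::real, y)) \<longlongrightarrow> (0, 0)) (nhds 0)"
    by (intro tendsto_intros filterlim_ident)+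
  \<comment> \<open>On the axis \<open>y = 0\<close> the second factor is the constant
    \<open>q\<close>; the positive factor \<open>q^2\<close> then cancels, leaving a condition on
    \<phi> alone.\<close>
  have "eventually (\<lambda>x. 0 \<le> p * q * s * (\<phi> x * q - p * q)) (nhds 0)"
    using eventually_compose_filterlim[OF side axes(1)] by (simp add: q_def)
  then have \<phi>_side: "eventually (\<lambda>x. 0 \<le> \<phi> 0 * s * (\<phi> x - \<phi> 0)) (nhds 0)"
  proof eventually_elim
    case (elim x)
    also have "p * q * s * (\<phi> x * q - p * q) = q\<^sup>2 * (p * s * (\<phi> x - p))"
      by (simp add: algebra_simps power2_eq_square)
    finally have "0 \<le> p * s * (\<phi> x - p)"
      using mult_le_cancel_left_pos[of "q\<^sup>2" 0 "p * s * (\<phi> x - p)"] pq by simp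
    then show ?case unfolding p_def .
  qed
  have "eventually (\<lambda>y. 0 \<le> p * q * s * (p * \<psi> y - p * q)) (nhds 0)"
    using eventually_compose_filterlim[OF side axes(2)] by (simp add: p_def)
  then have \<psi>_side: "eventually (\<lambda>y. 0 \<le> \<psi> 0 * s * (\<psi> y - \<psi> 0)) (nhds 0)"
  proof eventually_elim
    case (elim y)
    also have "p * q * s * (p * \<psi> y - p * q) = p\<^sup>2 * (q * s * (\<psi> y - q))"
      by (simp add: algebra_simps power2_eq_square)
    finally have "0 \<le> q * s * (\<psi> y - q)"
      using mult_le_cancel_left_pos[of "p\<^sup>2" 0 "q * s * (\<psi> y - q)"] pq by simp
    then show ?case unfolding q_def .
  qed
  \<comment> \<open>Equality of the three discriminants lets the \<open>s\<close> found for \<zeta>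
    serve in the expansion of \<phi>, and likewise of \<psi>.\<close>
  have s\<phi>: "s\<^sup>2 = (- b $ 1)\<^sup>2 - a $ 1 * c $ 1"
    using disc_same[of 1] s2 by simp
  obtain C\<phi> d\<phi> where C\<phi>: "0 < d\<phi>" "0 \<le> C\<phi>"
    "\<And>x. \<bar>x\<bar> < d\<phi> \<Longrightarrow> \<bar>\<phi> x - p - p * s * x\<^sup>2\<bar> \<le> C\<phi> * \<bar>x\<bar> ^ 3"
    using \<phi>.taylor_at_one_sided_extremum[OF s\<phi> pq(1)[unfolded p_def] \<phi>_side]
    unfolding p_def by blast
  have s\<psi>: "s\<^sup>2 = (- b $ 2)\<^sup>2 - a $ 2 * c $ 2"
    using disc_same[of 2] s2 by simp
  obtain C\<psi> d\<psi> where C\<psi>: "0 < d\<psi>" "0 \<le> C\<psi>"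
    "\<And>y. \<bar>y\<bar> < d\<psi> \<Longrightarrow> \<bar>\<psi> y - q - q * s * y\<^sup>2\<bar> \<le> C\<psi> * \<bar>y\<bar> ^ 3"
    using \<psi>.taylor_at_one_sided_extremum[OF s\<psi> pq(2)[unfolded q_def] \<psi>_side]
    unfolding q_def by blast
  define B where "B = C\<phi> * (\<bar>q\<bar> + \<bar>q * s\<bar> + C\<psi>) + (\<bar>p\<bar> + \<bar>p * s\<bar>) * C\<psi> + \<bar>p * q\<bar> * s\<^sup>2"
  have ev: "eventually (\<lambda>m. \<bar>(u m)\<^sup>2 - (norm m)\<^sup>2\<bar>
      \<le> max B C\<zeta> / A * (\<bar>u m\<bar> ^ 3 + norm m ^ 3)) (nhds (0, 0))"
  proof -
    define d where "d = min 1 (min d\<phi> d\<psi>)"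
    have "d > 0" using C\<phi> C\<psi> by (simp add: d_def)
    then have "eventually (\<lambda>m. norm m < d) (nhds (0 :: real \<times> real))"
      by (auto simp: eventually_nhds_metric)
    then have "eventually (\<lambda>m. norm m < d) (nhds (0 :: real, 0 :: real))"
      by (simp add: zero_prod_def)
    with in_U u_small[OF C\<zeta>(1)] show ?thesis
    proof eventually_elim
      case (elim m)
      obtain x y where m: "m = (x, y)" by fastforce
      have norm: "(norm m)\<^sup>2 = x\<^sup>2 + y\<^sup>2" by (simp add: m norm_Pair)
      have "\<bar>x\<bar> \<le> norm m" "\<bar>y\<bar> \<le> norm m"
        by (simp_all add: norm flip: power2_le_iff_abs_le[OF norm_ge_zero])
      then have xy: "\<bar>x\<bar> < d\<phi>" "\<bar>y\<bar> < d\<psi>" "norm m \<le> 1"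
        using elim by (auto simp: d_def)
      have 1: "\<bar>\<phi> x * \<psi> y - p * q - p * q * s * (norm m)\<^sup>2\<bar> \<le> B * norm m ^ 3"
        unfolding B_def
        by (rule product_taylor_bound[OF C\<phi>(3)[OF xy(1)] C\<psi>(3)[OF xy(2)] C\<phi>(2) C\<psi>(2) norm])
          (use xy in auto)
      have 2: "\<bar>\<phi> x * \<psi> y - p * q - p * q * s * (u m)\<^sup>2\<bar> \<le> C\<zeta> * \<bar>u m\<bar> ^ 3"
        using C\<zeta>(3)[of "u m"] elim assms(25)[of x y] by (simp add: m)
      \<comment> \<open>The estimates \<open>1\<close> and \<open>2\<close> expand the same value
        \<open>\<phi> x * \<psi> y\<close>, so in their difference only the quadratic terms and the
        remainders survive. Dividing by \<open>A > 0\<close> finishes.\<close>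
      have "A * \<bar>(u m)\<^sup>2 - (norm m)\<^sup>2\<bar> = \<bar>p * q * s * (u m)\<^sup>2 - p * q * s * (norm m)\<^sup>2\<bar>"
        by (simp add: A_def abs_mult flip: right_diff_distrib)
      also have "\<dots> \<le> C\<zeta> * \<bar>u m\<bar> ^ 3 + B * norm m ^ 3" using 1 2 by linarith
      also have "\<dots> \<le> max B C\<zeta> * \<bar>u m\<bar> ^ 3 + max B C\<zeta> * norm m ^ 3"
        by (intro add_mono mult_right_mono) auto
      finally show ?case using A by (simp add: field_simps)
    qed
  qed
  have zero: "(0 :: real \<times> real) = (0, 0)"
    by (simp add: zero_prod_def)
  have "\<exists>\<delta>\<in>{1, -1}. (\<lambda>m. u m - \<delta> * norm m) \<in> O[at (0, 0)](\<lambda>m. (norm m)\<^sup>2)"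
    by (rule norm_asymptotics_if_square_asymptotics[of U u, unfolded zero, OF _ assms(21-24) ev]) simp
  moreover have "(\<lambda>m. u m - \<delta> * norm m) = (\<lambda>(x, y). u (x, y) - \<delta> * sqrt (x\<^sup>2 + y\<^sup>2))" for \<delta>
    by (simp add: norm_Pair fun_eq_iff)
  moreover have "(\<lambda>m::real\<times>real. (norm m)\<^sup>2) = (\<lambda>(x, y). x\<^sup>2 + y\<^sup>2)"
    by (simp add: norm_Pair fun_eq_iff)
  ultimately show ?thesis by simp
qed

end
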